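(* Let $t,n\in\mathbb{N}$. There is an explicit bijection between the set $SC_t(n)$ of self-conjugate $t$-core partitions of $n$ and \[ \Big\{ (w_0, \dots, w_{\lfloor \frac t2 \rfloor-1})\in\mathbb{Z}^{\lfloor \frac t2 \rfloor} : \sum_{k=0}^{\lfloor \frac t2 \rfloor-1}w_k^2 = 4tn + \tfrac{t(t^2-1)}{6},\ w_k \equiv 2k+1 - t \pmod{2t} \text{ for all } k \Big\}. \]
   Context: A partition is a $t$-core if no hook length $h(j,k)=\lambda_j+\lambda'_k-j-k+1$ of a cell of its Ferrers–Young diagram is divisible by $t$, and is self-conjugate if it equals its conjugate (rows and columns interchanged). *)

theory Defs
  imports Complex_Main "HOL-Number_Theory.Cong"
begin

definition partitions :: "nat \<Rightarrow> nat list set" where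
  "partitions n = {xs. sorted_wrt (\<ge>) xs \<and> (\<forall>x\<in>set xs. 0 < x) \<and> sum_list xs = n}"

text \<open>Parts, rows and columns are numbered from 1; parts beyond the last one are 0.\<close>

definition part :: "nat list \<Rightarrow> nat \<Rightarrow> nat" where
  "part xs j = (if 1 \<le> j \<and> j \<le> length xs then xs ! (j - 1) else 0)"

definition diagram :: "nat list \<Rightarrow> (nat \<times> nat) set" where
  "diagram xs = {(j, k). 1 \<le> j \<and> j \<le> length xs \<and> 1 \<le> k \<and> k \<le> part xs j}"

definition conjugate :: "nat list \<Rightarrow> nat list" where
  "conjugate xs = map (\<lambda>k. card {j. (j, k) \<in> diagram xs}) [1..<Suc (part xs 1)]"

definition hook :: "nat list \<Rightarrow> nat \<Rightarrow> nat \<Rightarrow> int" where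
  "hook xs j k = int (part xs j) + int (part (conjugate xs) k) - int j - int k + 1"

definition is_core :: "nat \<Rightarrow> nat list \<Rightarrow> bool" where
  "is_core t xs \<longleftrightarrow> (\<forall>(j, k) \<in> diagram xs. \<not> int t dvd hook xs j k)"

definition SC :: "nat \<Rightarrow> nat \<Rightarrow> nat list set" where
  "SC t n = {xs \<in> partitions n. is_core t xs \<and> conjugate xs = xs}"

text \<open>Vectors in \<open>\<int>\<^sup>d\<close> are integer lists of length \<open>d\<close>. The equation is stated over the
  reals, so that the division by 6 is the ordinary one.\<close>

definition W :: "nat \<Rightarrow> nat \<Rightarrow> int list set" where
  "W t n = {w. length w = t div 2 \<and>
     real_of_int (\<Sum>k<t div 2. (w ! k)\<^sup>2)
       = 4 * real t * real n + real t * ((real t)\<^sup>2 - 1) / 6 \<and>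
     (\<forall>k<t div 2. [w ! k = 2 * int k + 1 - int t] (mod (2 * int t)))}"

text \<open>The \<open>n\<close>-vector of a \<open>t\<close>-core, following Garvan, Kim and Stanton. The last cell of
  row \<open>j\<close> has content \<open>part xs j - j\<close>. A cell has residue \<open>i\<close> and lies in region \<open>r\<close>
  iff its content is \<open>t (r - 1) + i\<close>, and the \<open>i\<close>-th entry is the largest region in
  which some row ends in a cell of residue \<open>i\<close>. Every \<open>j \<ge> 1\<close> is allowed (empty rows end
  in column 0), so that such regions exist for each \<open>i\<close>.\<close>

definition n_entry :: "nat \<Rightarrow> nat list \<Rightarrow> nat \<Rightarrow> int" where
  "n_entry t xs i =
     (GREATEST r. \<exists>j\<ge>1. int (part xs j) - int j = int t * (r - 1) + int i)"

text \<open>For a self-conjugate \<open>t\<close>-core, entries \<open>i\<close> and \<open>t - 1 - i\<close> of the \<open>n\<close>-vector sum to 0,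
  so its first \<open>t div 2\<close> entries determine it. Completing the square in
  \<open>n = t / 2 * (\<Sum>i<t. n\<^sub>i\<^sup>2) + (\<Sum>i<t. i * n\<^sub>i)\<close> gives the following coordinates.\<close>

definition w_vec :: "nat \<Rightarrow> nat list \<Rightarrow> int list" where
  "w_vec t xs =
     map (\<lambda>k. 2 * int t * n_entry t xs k + 2 * int k + 1 - int t) [0..<t div 2]"

end

theory Submission
  imports Defs
begin

text \<open>A partition is encoded by its set of beads \<open>part xs j - j\<close> with \<open>j \<ge> 1\<close>. The map
  \<open>z \<mapsto> - 1 - z\<close> takes the gaps to the beads of the conjugate, and hook lengths are the
  positive differences of a bead and a gap. So \<open>xs\<close> is a \<open>t\<close>-core iff the beads fill an
  initial part of every residue class modulo \<open>t\<close>, and the \<open>n\<close>-vector \<open>m\<close> records how far;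
  self-conjugacy means \<open>m (t - 1 - i) = - m i\<close>. A bead set
  with all integers below \<open>- N\<close> comes from a partition iff it has exactly \<open>N\<close> beads \<open>\<ge> - N\<close>,
  and the size of the partition is read off from the sum of these beads. For \<open>N\<close> a multiple
  of \<open>t\<close> both quantities can be summed along residue classes.\<close>

definition beta_set :: "nat list \<Rightarrow> int set" where
  "beta_set xs = {int (part xs j) - int j | j. 1 \<le> j}"

text \<open>The position \<open>int t * (r - 1) + int i\<close> has quotient \<open>r - 1\<close>,
  so the strict inequality fills runner \<open>i\<close> exactly up to region \<open>m i\<close>, in
  the region numbering of \<open>n_entry\<close>.\<close>

definition abacus :: "nat \<Rightarrow> (nat \<Rightarrow> int) \<Rightarrow> int set" where
  "abacus t m = {z. z div int t < m (nat (z mod int t))}"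

section \<open>Parts of a partition and of its conjugate\<close>

lemma part_beyond: "length xs < j \<Longrightarrow> part xs j = 0"
  by (simp add: part_def)

lemma part_antimono:
  assumes "sorted_wrt (\<ge>) xs" "1 \<le> i" "i \<le> j"
  shows "part xs j \<le> part xs i"
proof (cases "i = j")
  case False
  then show ?thesis
    using assms sorted_wrt_nth_less[OF assms(1), of "i - 1" "j - 1"]
    by (auto simp: part_def)
qed auto

lemma part_pos_iff:
  assumes "\<forall>x\<in>set xs. 0 < x" "1 \<le> j"
  shows "0 < part xs j \<longleftrightarrow> j \<le> length xs"
  using assms by (auto simp: part_def)

lemma part_conjugate:
  assumes "sorted_wrt (\<ge>) xs" "1 \<le> k"
  shows "part (conjugate xs) k = card {j. 1 \<le> j \<and> k \<le> part xs j}"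
proof -
  have *: "{j. (j, k) \<in> diagram xs} = {j. 1 \<le> j \<and> k \<le> part xs j}"
    using assms(2) by (auto simp: diagram_def part_def split: if_splits)
  show ?thesis
  proof (cases "k \<le> part xs 1")
    case True
    obtain l where l: "k = Suc l"
      using assms(2) by (cases k) auto
    show ?thesis
      using True unfolding l *[symmetric, unfolded l] conjugate_def
      by (simp add: part_def[of "map _ _"] del: upt_Suc)
  next
    case False
    then have "{j. 1 \<le> j \<and> k \<le> part xs j} = {}"
      using part_antimono[OF assms(1), of 1] by fastforce
    moreover have "part (conjugate xs) k = 0"
      using False by (intro part_beyond) (simp add: conjugate_def del: upt_Suc)
    ultimately show ?thesis by (simp only: card.empty)
  qed
qed

text \<open>Parts decrease, so column \<open>k\<close> occupies an initial segment of the rows; its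
  length is therefore at least \<open>j\<close> exactly when it meets row \<open>j\<close>.\<close>

lemma le_part_conjugate_iff:
  assumes "sorted_wrt (\<ge>) xs" "1 \<le> j" "1 \<le> k"
  shows "j \<le> part (conjugate xs) k \<longleftrightarrow> k \<le> part xs j"
proof -
  let ?A = "{j. 1 \<le> j \<and> k \<le> part xs j}"
  have fin: "finite ?A"
  proof (rule finite_subset)
    show "?A \<subseteq> {..length xs}"
      using assms(3) part_beyond by (metis (no_types, lifting) atMost_iff le_zero_eq mem_Collect_eq
          not_less not_one_le_zero subsetI)
  qed simp
  show ?thesis
  proof
    assume "k \<le> part xs j"
    then have "{1..j} \<subseteq> ?A"
      using part_antimono[OF assms(1)] order_trans by fastforce
    from card_mono[OF fin this] show "j \<le> part (conjugate xs) k"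
      by (simp add: part_conjugate[OF assms(1,3)])
  next
    assume le: "j \<le> part (conjugate xs) k"
    show "k \<le> part xs j"
    proof (rule ccontr)
      assume "\<not> k \<le> part xs j"
      then have "?A \<subseteq> {1..<j}"
        using part_antimono[OF assms(1) assms(2)] by (auto simp: not_le) (meson le_trans not_less)
      from card_mono[OF _ this] have "card ?A \<le> j - 1" by simp
      then show False
        using le assms(2) by (simp add: part_conjugate[OF assms(1,3)])
    qed
  qed
qed

lemma conjugate_partition:
  assumes "sorted_wrt (\<ge>) xs"
  shows "sorted_wrt (\<ge>) (conjugate xs)" "\<forall>x\<in>set (conjugate xs). 0 < x"
proof -
  have len: "length (conjugate xs) = part xs 1"
    by (simp add: conjugate_def del: upt_Suc)
  have nth: "conjugate xs ! i = part (conjugate xs) (Suc i)" if "i < length (conjugate xs)" for i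
    using that by (simp add: part_def)
  have anti: "part (conjugate xs) l \<le> part (conjugate xs) k" if "1 \<le> k" "k \<le> l" for k l
    using le_part_conjugate_iff[OF assms, of "part (conjugate xs) l"] that
    by (metis One_nat_def Suc_leI le_trans not_gr_zero order_refl zero_le)
  show "sorted_wrt (\<ge>) (conjugate xs)"
    by (auto simp: sorted_wrt_iff_nth_less nth anti)
  have "0 < part (conjugate xs) (Suc i)" if "i < length (conjugate xs)" for i
    using le_part_conjugate_iff[OF assms, of 1 "Suc i"] that len by simp
  then show "\<forall>x\<in>set (conjugate xs). 0 < x"
    by (metis in_set_conv_nth nth)
qed

section \<open>Beads, gaps and hook lengths\<close>

text \<open>If bead \<open>j\<close> met the reflection of conjugate bead \<open>k\<close>, then
  \<open>part xs j + part (conjugate xs) k = j + k - 1\<close>. By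
  \<open>le_part_conjugate_iff\<close> this sum is at least \<open>j + k\<close> or at most
  \<open>j + k - 2\<close>. Conversely, the first row with its bead below a gap \<open>z\<close>
  identifies the column that belongs to \<open>z\<close>.\<close>

lemma beta_set_conjugate:
  assumes "sorted_wrt (\<ge>) xs"
  shows "- 1 - z \<in> beta_set (conjugate xs) \<longleftrightarrow> z \<notin> beta_set xs"
proof
  assume "- 1 - z \<in> beta_set (conjugate xs)"
  then obtain k where k: "1 \<le> k" "- 1 - z = int (part (conjugate xs) k) - int k"
    by (auto simp: beta_set_def)
  show "z \<notin> beta_set xs"
  proof
    assume "z \<in> beta_set xs"
    then obtain j where j: "1 \<le> j" "z = int (part xs j) - int j"
      by (auto simp: beta_set_def)
    show False
      using le_part_conjugate_iff[OF assms j(1) k(1)] j k by linarith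
  qed
next
  assume z: "z \<notin> beta_set xs"
  define j where "j = (LEAST j. 1 \<le> j \<and> int (part xs j) - int j \<le> z)"
  have "\<exists>j. 1 \<le> j \<and> int (part xs j) - int j \<le> z"
    by (rule exI[of _ "Suc (length xs + nat (- z))"]) (simp add: part_beyond)
  then have j: "1 \<le> j" "int (part xs j) - int j \<le> z"
    unfolding j_def by (metis (mono_tags, lifting) LeastI)+
  have prev: "j = 1 \<or> z < int (part xs (j - 1)) - int (j - 1)"
    using not_less_Least[of "j - 1" "\<lambda>j. 1 \<le> j \<and> int (part xs j) - int j \<le> z"] j(1)
    unfolding j_def[symmetric] by linarith
  have lt: "int (part xs j) - int j < z"
    using j z by (force simp: beta_set_def)
  \<comment> \<open>Forced by \<open>- 1 - z = int (part (conjugate xs) k) - int k\<close> if column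
    \<open>k\<close> is to have length \<open>j - 1\<close>.\<close>
  define k where "k = nat (z + int j)"
  have k: "1 \<le> k" "int k = z + int j" "part xs j < k"
    using lt by (auto simp: k_def)
  have "part (conjugate xs) k < j"
    using le_part_conjugate_iff[OF assms j(1) k(1)] k(3) by linarith
  moreover have "j - 1 \<le> part (conjugate xs) k"
  proof (cases "j = 1")
    case False
    with prev j(1) k(2) have "k \<le> part xs (j - 1)" by linarith
    then show ?thesis
      using le_part_conjugate_iff[OF assms _ k(1), of "j - 1"] False j(1) by simp
  qed simp
  ultimately have "- 1 - z = int (part (conjugate xs) k) - int k"
    using k(2) j(1) by linarith
  then show "- 1 - z \<in> beta_set (conjugate xs)"
    using k(1) by (auto simp: beta_set_def)
qed

text \<open>The hook length of cell \<open>(j, k)\<close> is the difference of the \<open>j\<close>-th bead \<open>part xs j - j\<close>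
  and the \<open>k\<close>-th gap \<open>k - 1 - part (conjugate xs) k\<close>.\<close>

lemma is_core_iff_beta_set:
  assumes "sorted_wrt (\<ge>) xs"
  shows "is_core t xs \<longleftrightarrow>
    (\<forall>y z. z \<in> beta_set xs \<and> y < z \<and> int t dvd z - y \<longrightarrow> y \<in> beta_set xs)"
proof
  assume core: "is_core t xs"
  show "\<forall>y z. z \<in> beta_set xs \<and> y < z \<and> int t dvd z - y \<longrightarrow> y \<in> beta_set xs"
  proof (intro allI impI, rule ccontr)
    fix y z
    assume z: "z \<in> beta_set xs \<and> y < z \<and> int t dvd z - y" and y: "y \<notin> beta_set xs"
    from z obtain j where j: "1 \<le> j" "z = int (part xs j) - int j"
      by (auto simp: beta_set_def)
    from y have "- 1 - y \<in> beta_set (conjugate xs)"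
      by (simp add: beta_set_conjugate[OF assms])
    then obtain k where k: "1 \<le> k" "- 1 - y = int (part (conjugate xs) k) - int k"
      by (auto simp: beta_set_def)
    \<comment> \<open>Otherwise row \<open>j\<close> ends before column \<open>k\<close> and column
      \<open>k\<close> ends above row \<open>j\<close>, which would put the bead \<open>z\<close>
      below the gap \<open>y\<close>.\<close>
    have "k \<le> part xs j"
      using le_part_conjugate_iff[OF assms j(1) k(1)] j k z by linarith
    with j k have "(j, k) \<in> diagram xs"
      by (auto simp: diagram_def part_def split: if_splits)
    moreover have "hook xs j k = z - y"
      using j k by (simp add: hook_def)
    ultimately show False
      using core z by (auto simp: is_core_def)
  qed
next
  assume closed: "\<forall>y z. z \<in> beta_set xs \<and> y < z \<and> int t dvd z - y \<longrightarrow> y \<in> beta_set xs"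
  show "is_core t xs"
    unfolding is_core_def
  proof (clarify)
    fix j k
    assume "(j, k) \<in> diagram xs" and dvd: "int t dvd hook xs j k"
    then have jk: "1 \<le> j" "1 \<le> k" "k \<le> part xs j"
      by (auto simp: diagram_def)
    define y where "y = int k - 1 - int (part (conjugate xs) k)"
    define z where "z = int (part xs j) - int j"
    have "- 1 - y \<in> beta_set (conjugate xs)"
      using jk by (force simp: beta_set_def y_def)
    then have "y \<notin> beta_set xs"
      by (simp add: beta_set_conjugate[OF assms])
    moreover have "z \<in> beta_set xs"
      using jk by (auto simp: beta_set_def z_def)
    moreover have "y < z"
      using le_part_conjugate_iff[OF assms jk(1,2)] jk(3) by (simp add: y_def z_def)
    moreover have "int t dvd z - y"
      using dvd by (simp add: y_def z_def hook_def algebra_simps)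
    ultimately show False
      using closed by blast
  qed
qed

section \<open>Truncated bead sets and the size of a partition\<close>

text \<open>Row \<open>j\<close> has its bead at \<open>- int j\<close> or above, and exactly there
  if \<open>j\<close> exceeds \<open>N\<close>, since that row is empty.\<close>

lemma beta_set_truncate:
  assumes "sorted_wrt (\<ge>) xs" "length xs \<le> N"
  shows "beta_set xs \<inter> {- int N..} = (\<lambda>j. int (part xs j) - int j) ` {1..N}"
proof -
  have *: "int (part xs j) - int j \<in> {- int N..} \<longleftrightarrow> j \<le> N" for j
    using assms(2) part_beyond[of xs j] by (cases "j \<le> N") auto
  have "beta_set xs \<inter> {- int N..}
      = {int (part xs j) - int j | j. 1 \<le> j \<and> int (part xs j) - int j \<in> {- int N..}}"
    unfolding beta_set_def by blast
  also have "\<dots> = (\<lambda>j. int (part xs j) - int j) ` {1..N}"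
    unfolding * setcompr_eq_image by (rule image_cong) auto
  finally show ?thesis .
qed

lemma content_strict_antimono:
  assumes "sorted_wrt (\<ge>) xs" "1 \<le> i" "i < j"
  shows "int (part xs j) - int j < int (part xs i) - int i"
  using part_antimono[OF assms(1,2), of j] assms(3) by simp

lemma inj_on_content:
  assumes "sorted_wrt (\<ge>) xs"
  shows "inj_on (\<lambda>j. int (part xs j) - int j) {1..N}"
proof (rule linorder_inj_onI')
  fix i j :: nat assume "i \<in> {1..N}" "i < j"
  then show "int (part xs i) - int i \<noteq> int (part xs j) - int j"
    using content_strict_antimono[OF assms, of i j] by simp
qed

lemma sum_part: "length xs \<le> N \<Longrightarrow> (\<Sum>j\<in>{1..N}. part xs j) = sum_list xs"
proof -
  assume N: "length xs \<le> N"
  have "(\<Sum>j\<in>{1..N}. part xs j) = (\<Sum>j\<in>{1..length xs}. part xs j)"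
    using N by (intro sum.mono_neutral_right) (auto simp: part_beyond)
  also have "\<dots> = (\<Sum>i\<in>{0..<length xs}. part xs (Suc i))"
    by (simp add: sum.atLeast_Suc_atMost_Suc_shift atLeastLessThanSuc_atLeastAtMost[symmetric]
        sum.atLeast_Suc_lessThan_Suc_shift del: sum.op_ivl_Suc)
  also have "\<dots> = sum_list xs"
    by (simp add: part_def sum_list_sum_nth)
  finally show ?thesis .
qed

lemma sum_odd_int: "(\<Sum>j\<in>{1..N}. 2 * int j - 1) = (int N)\<^sup>2"
  by (induction N) (auto simp: power2_eq_square algebra_simps)

text \<open>Each cell contributes 2, and the beads of the empty partition contribute the negatives
  of the first \<open>N\<close> odd numbers. The weight \<open>2 * z + 1\<close> avoids
  halves.\<close>

lemma sum_beta_set_truncate: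
  assumes "sorted_wrt (\<ge>) xs" "length xs \<le> N"
  shows "(\<Sum>z\<in>beta_set xs \<inter> {- int N..}. 2 * z + 1) = 2 * int (sum_list xs) - (int N)\<^sup>2"
proof -
  have "(\<Sum>z\<in>beta_set xs \<inter> {- int N..}. 2 * z + 1)
      = (\<Sum>j\<in>{1..N}. 2 * (int (part xs j) - int j) + 1)"
    unfolding beta_set_truncate[OF assms] sum.reindex[OF inj_on_content[OF assms(1)]] by simp
  also have "\<dots> = (\<Sum>j\<in>{1..N}. 2 * int (part xs j)) - (\<Sum>j\<in>{1..N}. 2 * int j - 1)"
    by (subst sum_subtractf[symmetric]) (simp add: algebra_simps)
  also have "(\<Sum>j\<in>{1..N}. 2 * int (part xs j)) = 2 * int (sum_list xs)"
    by (simp add: sum_part[OF assms(2), symmetric] sum_distrib_left)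
  finally show ?thesis
    by (simp only: sum_odd_int)
qed

section \<open>Recovering a partition from its beads\<close>

text \<open>Pigeonhole: if \<open>part xs j < part ys j\<close>, the first \<open>j\<close> beads of
  \<open>ys\<close> all lie above bead \<open>j\<close> of \<open>xs\<close>, so they would have to
  be among the first \<open>j - 1\<close> beads of \<open>xs\<close>.\<close>

lemma beta_set_inject:
  assumes "sorted_wrt (\<ge>) xs" "\<forall>x\<in>set xs. 0 < x"
    and "sorted_wrt (\<ge>) ys" "\<forall>x\<in>set ys. 0 < x"
    and eq: "beta_set xs = beta_set ys"
  shows "xs = ys"
proof -
  have "\<not> part xs j < part ys j"
    if "sorted_wrt (\<ge>) xs" "sorted_wrt (\<ge>) ys" "beta_set xs = beta_set ys" "1 \<le> j" for xs ys j
  proof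
    assume lt: "part xs j < part ys j"
    define N where "N = max j (max (length xs) (length ys))"
    define z where "z = int (part ys j) - int j"
    have N: "j \<le> N" "length xs \<le> N" "length ys \<le> N"
      by (auto simp: N_def)
    let ?c = "\<lambda>xs i. int (part xs i) - int i"
    have "?c ys ` {1..j} \<subseteq> ?c xs ` {1..<j}"
    proof
      fix y assume "y \<in> ?c ys ` {1..j}"
      then obtain i where i: "1 \<le> i" "i \<le> j" "y = ?c ys i" by auto
      then have "y \<in> beta_set xs"
        using that(3) by (auto simp: beta_set_def)
      then obtain l where l: "1 \<le> l" "y = ?c xs l"
        by (auto simp: beta_set_def)
      have "l < j"
      proof (rule ccontr)
        assume "\<not> l < j"
        then have "part xs l \<le> part xs j" "j \<le> l"
          using part_antimono[OF that(1,4)] by auto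
        moreover have "part ys j \<le> part ys i"
          using part_antimono[OF that(2)] i by auto
        ultimately show False
          using l i lt by linarith
      qed
      with l show "y \<in> ?c xs ` {1..<j}" by auto
    qed
    from card_mono[OF _ this] have "j \<le> card (?c xs ` {1..<j})"
      using card_image[OF inj_on_content[OF that(2)], of j] by simp
    also have "\<dots> \<le> j - 1"
      using card_image_le[of "{1..<j}" "?c xs"] by simp
    finally show False using that(4) by simp
  qed
  then have part: "part xs j = part ys j" if "1 \<le> j" for j
    using assms that by (metis linorder_neqE_nat)
  have len: "length xs = length ys"
    using part part_pos_iff[OF assms(2)] part_pos_iff[OF assms(4)]
    by (metis One_nat_def Suc_leI le_antisym le_zero_eq linorder_not_le nat_le_linear not_less_eq_eq)
  show ?thesis
  proof (rule nth_equalityI[OF len])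
    fix i assume "i < length xs"
    then show "xs ! i = ys ! i"
      using part[of "Suc i"] len by (simp add: part_def)
  qed
qed

text \<open>The \<open>N\<close> beads from \<open>- N\<close> upwards, in decreasing order, are
  those of rows 1 to \<open>N\<close>. As there are exactly \<open>N\<close> of them, the positions
  below \<open>- N\<close> are the beads of the empty rows after row \<open>N\<close>.\<close>

lemma partition_of_beta_set:
  assumes low: "{..< - int N} \<subseteq> S" and card: "card (S \<inter> {- int N..}) = N"
    and fin: "finite (S \<inter> {- int N..})"
  obtains xs where "sorted_wrt (\<ge>) xs" "\<forall>x\<in>set xs. 0 < x" "beta_set xs = S"
proof -
  define T where "T = S \<inter> {- int N..}"
  define L where "L = rev (sorted_list_of_set T)"
  have len: "length L = N" and setL: "set L = T"
    using card fin by (simp_all add: L_def T_def)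
  have strict: "sorted_wrt (>) L"
    unfolding L_def by (simp add: sorted_wrt_rev strict_sorted_iff)
  \<comment> \<open>Indices start at 0 here: \<open>L ! i\<close> is the bead of row
    \<open>i + 1\<close>, whose part is the bead plus the row number.\<close>
  define p where "p i = (if i < N then L ! i + int i + 1 else 0)" for i
  have step: "p (Suc i) \<le> p i" if "Suc i < N" for i
    using sorted_wrt_nth_less[OF strict, of i "Suc i"] that len by (simp add: p_def)
  \<comment> \<open>The last bead is at least \<open>- N\<close>, which settles
    \<open>i = N - 1\<close>; \<open>step\<close> carries this down to smaller indices.\<close>
  have nonneg: "0 \<le> p i" for i
  proof (cases "i < N")
    case True
    then show ?thesis
    proof (induction rule: strict_inc_induct)
      case (base i)
      then have "L ! i \<in> T" using len setL nth_mem[of i L] by auto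
      then show ?case using base by (simp add: p_def T_def)
    next
      case (step i)
      then show ?case using \<open>\<And>i. Suc i < N \<Longrightarrow> p (Suc i) \<le> p i\<close>[of i] by simp
    qed
  qed (simp add: p_def)
  have anti: "p j \<le> p i" if "i \<le> j" for i j
    using that
  proof (induction rule: dec_induct)
    case (step m)
    have "p (Suc m) \<le> p m"
      using \<open>\<And>i. Suc i < N \<Longrightarrow> p (Suc i) \<le> p i\<close>[of m] nonneg[of m]
      by (cases "Suc m < N") (auto simp: p_def)
    then show ?case using step by simp
  qed simp
  \<comment> \<open>The sequence \<open>p\<close> may end in zeros before index \<open>N\<close>;
    cutting at the first one leaves only positive parts.\<close>
  define n where "n = (LEAST i. p i = 0)"
  have pN: "p N = 0" by (simp add: p_def)
  have n0: "p n = 0"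
    unfolding n_def using pN by (rule LeastI)
  have pos: "0 < p i" if "i < n" for i
    using not_less_Least[of i "\<lambda>i. p i = 0"] that nonneg[of i] unfolding n_def by simp
  define xs where "xs = map (\<lambda>i. nat (p i)) [0..<n]"
  have part: "int (part xs (Suc i)) = p i" for i
    using anti[of n i] nonneg[of i] n0 by (auto simp: part_def xs_def)
  have sorted: "sorted_wrt (\<ge>) xs"
    by (auto simp: sorted_wrt_iff_nth_less xs_def intro!: nat_mono anti)
  have lenN: "length xs \<le> N"
    using Least_le[of "\<lambda>i. p i = 0", OF pN] by (simp add: xs_def n_def)
  have "beta_set xs \<inter> {- int N..} = (\<lambda>j. int (part xs j) - int j) ` Suc ` {..<N}"
    by (simp add: beta_set_truncate[OF sorted lenN] image_Suc_lessThan)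
  also have "\<dots> = (\<lambda>i. L ! i) ` {..<N}"
    unfolding image_image by (intro image_cong) (auto simp: part p_def)
  also have "\<dots> = S \<inter> {- int N..}"
    using setL len nth_image[of N L] by (simp add: T_def lessThan_atLeast0)
  finally have high: "beta_set xs \<inter> {- int N..} = S \<inter> {- int N..}" .
  have "{..< - int N} \<subseteq> beta_set xs"
  proof
    fix z assume "z \<in> {..< - int N}"
    then have "1 \<le> nat (- z)" "z = int (part xs (nat (- z))) - int (nat (- z))"
      using lenN by (simp_all add: part_beyond)
    then show "z \<in> beta_set xs"
      unfolding beta_set_def by blast
  qed
  moreover have "(UNIV :: int set) = {..< - int N} \<union> {- int N..}"
    by auto
  ultimately have "beta_set xs = S"
    using high low by blast
  moreover have "\<forall>x\<in>set xs. 0 < x"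
    using pos by (auto simp: xs_def)
  ultimately show ?thesis
    using that sorted by blast
qed

section \<open>Cores and self-conjugacy on the abacus\<close>

lemma mem_abacus:
  assumes "i < t"
  shows "int t * (r - 1) + int i \<in> abacus t m \<longleftrightarrow> r \<le> m i"
proof -
  have "(int t * (r - 1) + int i) div int t = r - 1" "(int t * (r - 1) + int i) mod int t = int i"
    using assms by auto
  then show ?thesis by (auto simp: abacus_def)
qed

lemma abacus_position:
  fixes z :: int
  assumes "1 \<le> t"
  obtains i r where "i < t" "z = int t * (r - 1) + int i"
proof
  show "nat (z mod int t) < t"
    using assms by (simp add: nat_less_iff)
  show "z = int t * (z div int t + 1 - 1) + int (nat (z mod int t))"
    using assms by simp
qed

lemma n_entry_abacus:
  assumes "beta_set xs = abacus t m" "i < t"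
  shows "n_entry t xs i = m i"
proof -
  have "(\<exists>j\<ge>1. int (part xs j) - int j = int t * (r - 1) + int i) \<longleftrightarrow> r \<le> m i" for r
    using mem_abacus[OF assms(2), of r m] by (auto simp: assms(1)[symmetric] beta_set_def)
  then show ?thesis
    unfolding n_entry_def by (simp add: Greatest_equality)
qed

text \<open>Yields the level up to which a single runner is filled. Restricting to \<open>r\<close>
  from \<open>a\<close> on makes the set finite, so that its maximum exists.\<close>

lemma int_down_set_eq_atMost:
  fixes P :: "int \<Rightarrow> bool"
  assumes down: "\<And>r s. P r \<Longrightarrow> s < r \<Longrightarrow> P s" and "P a" and bound: "\<And>r. P r \<Longrightarrow> r \<le> b"
  shows "\<exists>q. \<forall>r. P r \<longleftrightarrow> r \<le> q"
proof -
  let ?A = "{r. a \<le> r \<and> P r}"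
  have fin: "finite ?A"
    by (rule finite_subset[of _ "{a..b}"]) (auto dest: bound)
  have mem: "Max ?A \<in> ?A"
    using \<open>P a\<close> by (intro Max_in fin) auto
  have "P r \<longleftrightarrow> r \<le> Max ?A" for r
  proof
    assume "P r"
    then show "r \<le> Max ?A"
      using Max_ge[OF fin, of r] mem by (cases "a \<le> r") auto
  next
    assume "r \<le> Max ?A"
    then show "P r"
      using mem down[of "Max ?A" r] by (cases "r = Max ?A") auto
  qed
  then show ?thesis by blast
qed

text \<open>By \<open>is_core_iff_beta_set\<close> the occupied regions of each runner are closed
  downwards, and they are nonempty and bounded above, so they have a top region \<open>m i\<close>.
  Conversely, going down by a multiple of \<open>t\<close> keeps the residue and does not raise the
  quotient.\<close>

lemma is_core_iff_abacus:
  assumes "sorted_wrt (\<ge>) xs" "1 \<le> t"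
  shows "is_core t xs \<longleftrightarrow> (\<exists>m. beta_set xs = abacus t m)"
proof
  assume "is_core t xs"
  then have closed: "y \<in> beta_set xs" if "z \<in> beta_set xs" "y < z" "int t dvd z - y" for y z
    using that is_core_iff_beta_set[OF assms(1)] by blast
  have "\<exists>q. \<forall>r. int t * (r - 1) + int i \<in> beta_set xs \<longleftrightarrow> r \<le> q" if "i < t" for i
  proof (rule int_down_set_eq_atMost)
    show "int t * (s - 1) + int i \<in> beta_set xs"
      if "int t * (r - 1) + int i \<in> beta_set xs" "s < r" for r s
    proof (rule closed[OF that(1)])
      show "int t * (s - 1) + int i < int t * (r - 1) + int i"
        using assms(2) that(2) by simp
      have "int t * (r - 1) + int i - (int t * (s - 1) + int i) = int t * (r - s)"
        by (simp add: algebra_simps)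
      then show "int t dvd int t * (r - 1) + int i - (int t * (s - 1) + int i)"
        by simp
    qed
    \<comment> \<open>Region \<open>?a\<close> of each runner lies below
      \<open>- int (length xs)\<close>, where every position is the bead of an empty row.\<close>
    let ?a = "- int (length xs)"
    have "int t * (?a - 1) + int i = int t * ?a + (int i - int t)"
      by (simp add: algebra_simps)
    also have "\<dots> < ?a"
      using that assms(2) mult_right_mono_neg[of 1 "int t" ?a] by simp
    finally have *: "int t * (?a - 1) + int i < ?a" .
    show "int t * (?a - 1) + int i \<in> beta_set xs"
      unfolding beta_set_def mem_Collect_eq
      using * by (intro exI[of _ "nat (- (int t * (?a - 1) + int i))"])
        (auto simp: part_beyond)
    \<comment> \<open>A bead in a higher region would be at least \<open>r - 1\<close>, hence beyond
      the first part.\<close>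
    show "r \<le> int (part xs 1) + 1" if "int t * (r - 1) + int i \<in> beta_set xs" for r
    proof (rule ccontr)
      assume r: "\<not> r \<le> int (part xs 1) + 1"
      from that obtain j where j: "1 \<le> j" "int t * (r - 1) + int i = int (part xs j) - int j"
        by (auto simp: beta_set_def)
      have "r - 1 \<le> int t * (r - 1)"
        using assms(2) r mult_right_mono[of 1 "int t" "r - 1"] by simp
      moreover have "int (part xs j) \<le> int (part xs 1)"
        using part_antimono[OF assms(1) order_refl j(1)] by simp
      moreover have "int t * (r - 1) \<le> int (part xs j) - int j"
        using j(2) by simp
      ultimately show False
        using r by linarith
    qed
  qed
  then obtain m where m: "\<And>i r. i < t \<Longrightarrow> int t * (r - 1) + int i \<in> beta_set xs \<longleftrightarrow> r \<le> m i"
    by metis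
  have "z \<in> beta_set xs \<longleftrightarrow> z \<in> abacus t m" for z
    by (rule abacus_position[OF assms(2), of z]) (simp add: m mem_abacus)
  then show "\<exists>m. beta_set xs = abacus t m" by blast
next
  assume "\<exists>m. beta_set xs = abacus t m"
  then obtain m where m: "beta_set xs = abacus t m" by blast
  show "is_core t xs"
    unfolding is_core_iff_beta_set[OF assms(1)] m
  proof (intro allI impI)
    fix y z assume z: "z \<in> abacus t m \<and> y < z \<and> int t dvd z - y"
    have "z mod int t = y mod int t"
      using z by (simp add: mod_eq_dvd_iff)
    moreover have "y div int t \<le> z div int t"
      using z assms(2) by (intro zdiv_mono1) auto
    ultimately show "y \<in> abacus t m"
      using z by (auto simp: abacus_def)
  qed
qed

text \<open>The reflection takes region \<open>r\<close> of runner \<open>i\<close> to region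
  \<open>1 - r\<close> of runner \<open>t - 1 - i\<close>, so it exchanges beads and gaps iff the
  fill levels of these runners are opposite.\<close>

lemma abacus_symmetric_iff:
  assumes "1 \<le> t"
  shows "(\<forall>z. - 1 - z \<in> abacus t m \<longleftrightarrow> z \<notin> abacus t m) \<longleftrightarrow> (\<forall>i<t. m (t - 1 - i) = - m i)"
proof -
  have pos: "- 1 - (int t * (r - 1) + int i) = int t * ((1 - r) - 1) + int (t - 1 - i)"
    if "i < t" for i r
    using that by (simp add: of_nat_diff algebra_simps)
  have "(\<forall>z. - 1 - z \<in> abacus t m \<longleftrightarrow> z \<notin> abacus t m) \<longleftrightarrow>
      (\<forall>i<t. \<forall>r. 1 - r \<le> m (t - 1 - i) \<longleftrightarrow> \<not> r \<le> m i)"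
    (is "?L \<longleftrightarrow> ?R")
  proof
    show ?R if ?L
    proof (intro allI impI)
      fix i r assume i: "i < t"
      then have i': "t - 1 - i < t" by simp
      show "1 - r \<le> m (t - 1 - i) \<longleftrightarrow> \<not> r \<le> m i"
        using spec[OF that, of "int t * (r - 1) + int i"]
        unfolding pos[OF i] mem_abacus[OF i] mem_abacus[OF i'] by blast
    qed
    show ?L if ?R
    proof
      fix z
      obtain i r where z: "i < t" "z = int t * (r - 1) + int i"
        using abacus_position[OF assms] by blast
      have "t - 1 - i < t" using z by simp
      then show "- 1 - z \<in> abacus t m \<longleftrightarrow> z \<notin> abacus t m"
        unfolding z(2) pos[OF z(1)] by (simp only: mem_abacus z(1)) (use that z(1) in blast)
    qed
  qed
  also have "\<dots> \<longleftrightarrow> (\<forall>i<t. m (t - 1 - i) = - m i)"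
  proof (intro all_cong)
    fix i assume "i < t"
    show "(\<forall>r. 1 - r \<le> m (t - 1 - i) \<longleftrightarrow> \<not> r \<le> m i) \<longleftrightarrow> m (t - 1 - i) = - m i"
    proof
      assume *: "\<forall>r. 1 - r \<le> m (t - 1 - i) \<longleftrightarrow> \<not> r \<le> m i"
      show "m (t - 1 - i) = - m i"
        \<comment> \<open>The last occupied region gives one inequality, the first free region the
          other.\<close>
        using spec[OF *, of "m i"] spec[OF *, of "m i + 1"] by linarith
    qed auto
  qed
  finally show ?thesis .
qed

section \<open>Counting and summing the beads of an abacus\<close>

text \<open>A cut at a multiple of \<open>t\<close> falls between two regions, so every runner loses
  exactly the regions up to \<open>- M\<close>.\<close>

lemma abacus_truncate:
  assumes "1 \<le> t"
  defines "f \<equiv> \<lambda>(i, r). int t * (r - 1) + int i"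
  shows "abacus t m \<inter> {- int (t * M)..} = f ` (SIGMA i:{..<t}. {- int M<..m i})" (is ?eq)
    and "inj_on f (SIGMA i:{..<t}. {- int M<..m i})" (is ?inj)
proof -
  have ge: "- int (t * M) \<le> int t * (r - 1) + int i \<longleftrightarrow> - int M < r" if "i < t" for i r
  proof
    assume "- int (t * M) \<le> int t * (r - 1) + int i"
    then have "int t * (- int M) < int t * r"
      using that by (simp add: algebra_simps)
    then show "- int M < r"
      using assms(1) mult_less_cancel_left_pos[of "int t" "- int M" r] by simp
  next
    assume "- int M < r"
    then have "int t * (- int M) \<le> int t * (r - 1)"
      by (intro mult_left_mono) auto
    then show "- int (t * M) \<le> int t * (r - 1) + int i" by simp
  qed
  show ?eq
  proof (intro set_eqI iffI)
    fix z assume z: "z \<in> abacus t m \<inter> {- int (t * M)..}"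
    obtain i r where ir: "i < t" "z = int t * (r - 1) + int i"
      using abacus_position[OF assms(1)] by blast
    show "z \<in> f ` (SIGMA i:{..<t}. {- int M<..m i})"
      using z ge[OF ir(1), of r] mem_abacus[OF ir(1), of r m] ir
      by (intro image_eqI[of _ _ "(i, r)"]) (auto simp: f_def)
  next
    fix z assume "z \<in> f ` (SIGMA i:{..<t}. {- int M<..m i})"
    then obtain i r where ir: "i < t" "z = int t * (r - 1) + int i" "- int M < r" "r \<le> m i"
      by (auto simp: f_def)
    then show "z \<in> abacus t m \<inter> {- int (t * M)..}"
      using ge[OF ir(1), of r] mem_abacus[OF ir(1), of r m] by simp
  qed
  show ?inj
  proof (rule inj_onI, clarsimp simp: f_def)
    fix i r j s
    assume ij: "i < t" "j < t" and eq: "int t * (r - 1) + int i = int t * (s - 1) + int j"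
    have "(int t * (r - 1) + int i) mod int t = int i" "(int t * (s - 1) + int j) mod int t = int j"
      using ij by auto
    with eq have "i = j" by simp
    with eq ij show "i = j \<and> r = s" by simp
  qed
qed

text \<open>Runner \<open>i\<close> keeps \<open>m i + M\<close> beads, a number that the lower
  bound on \<open>m\<close> makes nonnegative. The count required of a partition thus amounts to the
  \<open>m i\<close> having sum 0.\<close>

lemma card_abacus_truncate:
  assumes "1 \<le> t" "\<forall>i<t. - int M \<le> m i"
  shows "int (card (abacus t m \<inter> {- int (t * M)..})) = int (t * M) + (\<Sum>i<t. m i)"
proof -
  have "int (card (abacus t m \<inter> {- int (t * M)..})) = (\<Sum>i<t. int (nat (m i + int M)))"
    unfolding abacus_truncate(1)[OF assms(1)] card_image[OF abacus_truncate(2)[OF assms(1)]]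
    by (simp add: add.commute)
  also have "\<dots> = (\<Sum>i<t. m i + int M)"
    using assms(2) by (intro sum.cong) (fastforce simp: minus_le_iff)+
  finally show ?thesis by (simp add: sum.distrib)
qed

lemma finite_abacus_truncate: "1 \<le> t \<Longrightarrow> finite (abacus t m \<inter> {- int (t * M)..})"
  unfolding abacus_truncate(1) by simp

text \<open>Telescopes, as \<open>2 * (r - 1)\<close> is the increment of
  \<open>r * (r - 1)\<close>.\<close>

lemma sum_runner:
  fixes a b t c :: int
  assumes "a \<le> b"
  shows "(\<Sum>r\<in>{a<..b}. 2 * t * (r - 1) + c) = t * (b * (b - 1) - a * (a - 1)) + c * (b - a)"
  using assms
proof (induction b rule: int_ge_induct)
  case (step b)
  have "{a<..b + 1} = insert (b + 1) {a<..b}"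
    using step by auto
  then show ?case
    using step by (simp add: algebra_simps)
qed simp

lemma sum_abacus_truncate:
  assumes "1 \<le> t" "\<forall>i<t. - int M \<le> m i" "(\<Sum>i<t. m i) = 0"
  shows "(\<Sum>z\<in>abacus t m \<inter> {- int (t * M)..}. 2 * z + 1)
    = (\<Sum>i<t. int t * (m i)\<^sup>2 + 2 * int i * m i) - (int (t * M))\<^sup>2"
proof -
  have odd: "(\<Sum>i<t. 2 * int i + 1) = (int t)\<^sup>2"
    by (induction t) (auto simp: power2_eq_square algebra_simps)
  have "(\<Sum>z\<in>abacus t m \<inter> {- int (t * M)..}. 2 * z + 1)
      = (\<Sum>(i, r)\<in>(SIGMA i:{..<t}. {- int M<..m i}). 2 * (int t * (r - 1) + int i) + 1)"
    unfolding abacus_truncate(1)[OF assms(1)] sum.reindex[OF abacus_truncate(2)[OF assms(1)]]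
    by (simp add: case_prod_unfold)
  also have "\<dots> = (\<Sum>i<t. \<Sum>r\<in>{- int M<..m i}. 2 * int t * (r - 1) + (2 * int i + 1))"
    by (subst sum.Sigma[symmetric]) (auto simp: algebra_simps)
  also have "\<dots> = (\<Sum>i<t. int t * (m i * (m i - 1) - (- int M) * (- int M - 1))
      + (2 * int i + 1) * (m i - (- int M)))"
    using assms(2) by (intro sum.cong sum_runner) auto
  \<comment> \<open>Isolates the term linear in \<open>m i\<close> that vanishes because the
    \<open>m i\<close> sum to 0. The terms free of \<open>m i\<close> add up to minus the square of
    \<open>t * M\<close>, matching \<open>sum_beta_set_truncate\<close> at
    \<open>N = t * M\<close>.\<close>
  also have "\<dots> = (\<Sum>i<t. (int t * (m i)\<^sup>2 + 2 * int i * m i) + (1 - int t) * m i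
      - int t * (int M * (int M + 1)) + int M * (2 * int i + 1))"
    by (intro sum.cong) (auto simp: power2_eq_square algebra_simps)
  also have "\<dots> = (\<Sum>i<t. int t * (m i)\<^sup>2 + 2 * int i * m i) + (1 - int t) * (\<Sum>i<t. m i)
      - int t * (int t * (int M * (int M + 1))) + int M * (\<Sum>i<t. 2 * int i + 1)"
    unfolding sum_distrib_left by (simp add: sum.distrib sum_subtractf)
  finally show ?thesis
    by (simp only: odd assms(3)) (simp add: power2_eq_square algebra_simps)
qed

section \<open>The size formula in square-completed form\<close>

lemma sum_reflect_lessThan:
  fixes f :: "nat \<Rightarrow> int"
  shows "(\<Sum>i<t. f (t - 1 - i)) = (\<Sum>i<t. f i)"
  using sum.nat_diff_reindex[of f t] by simp

lemma sum_symmetric_lessThan: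
  fixes f :: "nat \<Rightarrow> int"
  assumes sym: "\<And>i. i < t \<Longrightarrow> f (t - 1 - i) = f i" and mid: "odd t \<Longrightarrow> f (t div 2) = 0"
  shows "(\<Sum>i<t. f i) = 2 * (\<Sum>i<t div 2. f i)"
proof -
  have upper: "(\<Sum>i\<in>{t - t div 2..<t}. f i) = (\<Sum>i<t div 2. f i)"
    by (rule sum.reindex_bij_witness[of _ "\<lambda>i. t - 1 - i" "\<lambda>i. t - 1 - i"])
      (use sym in auto)
  have "(\<Sum>i<t. f i) = (\<Sum>i<t div 2. f i) + (\<Sum>i\<in>{t div 2..<t - t div 2}. f i)
      + (\<Sum>i\<in>{t - t div 2..<t}. f i)"
    using sum.atLeastLessThan_concat[of 0 "t div 2" "t - t div 2" f]
      sum.atLeastLessThan_concat[of 0 "t - t div 2" t f]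
    by (simp add: lessThan_atLeast0)
  moreover have "(\<Sum>i\<in>{t div 2..<t - t div 2}. f i) = 0"
  proof (rule sum.neutral, clarify)
    fix i assume "i \<in> {t div 2..<t - t div 2}"
    then have "odd t" "i = t div 2" by simp_all presburger+
    then show "f i = 0" using mid by simp
  qed
  ultimately show ?thesis using upper by simp
qed

text \<open>The shift \<open>c\<close> is kept apart from \<open>t\<close> so that induction on
  \<open>t\<close> applies. At \<open>c = int t\<close> the right-hand side is
  \<open>int t * ((int t)\<^sup>2 - 1)\<close>, the source of the constant in
  \<open>W\<close>.\<close>

lemma sum_squares_arith: "3 * (\<Sum>i<t. (2 * int i + 1 - c)\<^sup>2)
    = int t * (4 * (int t)\<^sup>2 - 1) - 6 * c * (int t)\<^sup>2 + 3 * c\<^sup>2 * int t"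
  by (induction t) (auto simp: power2_eq_square algebra_simps)

text \<open>Supplies a truncation level below which all runners are full; \<open>K\<close> lets it
  also exceed the number of parts.\<close>

lemma lower_bound_lessThan:
  fixes m :: "nat \<Rightarrow> int"
  obtains M where "K \<le> M" "\<forall>i<t. - int M \<le> m i"
proof
  let ?M = "K + (\<Sum>i<t. nat (- m i))"
  show "K \<le> ?M" by simp
  show "\<forall>i<t. - int ?M \<le> m i"
  proof (intro allI impI)
    fix i assume "i < t"
    have "nat (- m i) \<le> ?M"
      using member_le_sum[of i "{..<t}" "\<lambda>i. nat (- m i)"] \<open>i < t\<close>
      by (simp add: trans_le_add2)
    then show "- int ?M \<le> m i" by linarith
  qed
qed

lemma sum_antisymmetric:
  fixes m :: "nat \<Rightarrow> int"
  assumes "\<forall>i<t. m (t - 1 - i) = - m i"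
  shows "(\<Sum>i<t. m i) = 0"
  using assms sum_reflect_lessThan[of m t] by (simp add: sum_negf)

text \<open>Two evaluations of the truncated bead sum give the size as a quadratic form in
  \<open>m\<close>. Completing the square turns it into a sum of squares over all
  \<open>i < t\<close>, which is twice the sum over the first half since reflecting the index
  negates \<open>?w\<close>.\<close>

lemma sum_list_eq_abacus:
  assumes "1 \<le> t" "sorted_wrt (\<ge>) xs" "beta_set xs = abacus t m"
    and anti: "\<forall>i<t. m (t - 1 - i) = - m i"
  shows "6 * (\<Sum>k<t div 2. (2 * int t * m k + 2 * int k + 1 - int t)\<^sup>2)
    = 24 * int t * int (sum_list xs) + int t * ((int t)\<^sup>2 - 1)"
proof -
  let ?w = "\<lambda>k. 2 * int t * m k + 2 * int k + 1 - int t"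
  obtain M where M: "length xs \<le> M" "\<forall>i<t. - int M \<le> m i"
    using lower_bound_lessThan by blast
  have "length xs \<le> t * M"
    using M(1) assms(1) by (metis mult.left_neutral mult_le_mono)
  from sum_beta_set_truncate[OF assms(2) this]
  have size: "2 * int (sum_list xs) = (\<Sum>i<t. int t * (m i)\<^sup>2 + 2 * int i * m i)"
    unfolding assms(3) sum_abacus_truncate[OF assms(1) M(2) sum_antisymmetric[OF anti]]
    by linarith
  have "(\<Sum>i<t. (?w i)\<^sup>2) = 2 * (\<Sum>k<t div 2. (?w k)\<^sup>2)"
  proof (rule sum_symmetric_lessThan)
    fix i assume "i < t"
    then have "?w (t - 1 - i) = - ?w i"
      using anti by (simp add: of_nat_diff algebra_simps)
    then show "(?w (t - 1 - i))\<^sup>2 = (?w i)\<^sup>2"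
      by (metis power2_minus)
  next
    assume "odd t"
    \<comment> \<open>The middle index is its own reflection, so \<open>m\<close> vanishes there,
      and so does the shift \<open>2 * k + 1 - t\<close>.\<close>
    then have "t - 1 - t div 2 = t div 2" "t div 2 < t" "int t = 2 * int (t div 2) + 1"
      by presburger+
    then show "(?w (t div 2))\<^sup>2 = 0"
      using anti by fastforce
  qed
  moreover have "(\<Sum>i<t. (?w i)\<^sup>2) = (\<Sum>i<t. 4 * int t * (int t * (m i)\<^sup>2 + 2 * int i * m i)
      + 4 * int t * (1 - int t) * m i + (2 * int i + 1 - int t)\<^sup>2)"
    by (intro sum.cong) (auto simp: power2_eq_square algebra_simps)
  then have "(\<Sum>i<t. (?w i)\<^sup>2) = 4 * int t * (\<Sum>i<t. int t * (m i)\<^sup>2 + 2 * int i * m i)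
      + 4 * int t * (1 - int t) * (\<Sum>i<t. m i) + (\<Sum>i<t. (2 * int i + 1 - int t)\<^sup>2)"
    unfolding sum_distrib_left by (simp only: sum.distrib)
  ultimately have "6 * (\<Sum>k<t div 2. (?w k)\<^sup>2)
      = 24 * int t * int (sum_list xs) + 3 * (\<Sum>i<t. (2 * int i + 1 - int t)\<^sup>2)"
    unfolding size[symmetric] sum_antisymmetric[OF anti] by simp
  then show ?thesis
    unfolding sum_squares_arith by (simp add: power2_eq_square algebra_simps)
qed

section \<open>The bijection\<close>

text \<open>A partition is determined by its beads, so self-conjugacy says that the bead set is
  exchanged with its complement by the reflection, which on an abacus is antisymmetry of
  \<open>m\<close>.\<close>

lemma SC_iff_abacus:
  assumes "1 \<le> t"
  shows "xs \<in> SC t n \<longleftrightarrow> sorted_wrt (\<ge>) xs \<and> (\<forall>x\<in>set xs. 0 < x) \<and> sum_list xs = n \<and>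
    (\<exists>m. beta_set xs = abacus t m \<and> (\<forall>i<t. m (t - 1 - i) = - m i))"
proof -
  have "conjugate xs = xs \<longleftrightarrow> (\<forall>i<t. m (t - 1 - i) = - m i)"
    if xs: "sorted_wrt (\<ge>) xs" "\<forall>x\<in>set xs. 0 < x" and m: "beta_set xs = abacus t m" for m
  proof -
    have "conjugate xs = xs \<longleftrightarrow> beta_set (conjugate xs) = beta_set xs"
      using beta_set_inject[OF conjugate_partition[OF xs(1)] xs] by auto
    also have "\<dots> \<longleftrightarrow> (\<forall>z. - 1 - z \<in> beta_set (conjugate xs) \<longleftrightarrow> - 1 - z \<in> beta_set xs)"
      unfolding set_eq_iff by (metis diff_diff_eq2 add_diff_cancel_left')
    also have "\<dots> \<longleftrightarrow> (\<forall>z. - 1 - z \<in> beta_set xs \<longleftrightarrow> z \<notin> beta_set xs)"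
      using beta_set_conjugate[OF xs(1)] by auto
    finally show ?thesis
      unfolding m abacus_symmetric_iff[OF assms] .
  qed
  then show ?thesis
    using is_core_iff_abacus[OF _ assms, of xs] unfolding SC_def partitions_def mem_Collect_eq
    by (metis (no_types, lifting))
qed

text \<open>Clearing the denominator 6 moves the equation from the reals to the integers.\<close>

lemma W_iff:
  "w \<in> W t n \<longleftrightarrow> length w = t div 2 \<and>
     6 * (\<Sum>k<t div 2. (w ! k)\<^sup>2) = 24 * int t * int n + int t * ((int t)\<^sup>2 - 1) \<and>
     (\<forall>k<t div 2. [w ! k = 2 * int k + 1 - int t] (mod (2 * int t)))"
proof -
  have "real_of_int s = 4 * real t * real n + real t * ((real t)\<^sup>2 - 1) / 6 \<longleftrightarrow>
      6 * s = 24 * int t * int n + int t * ((int t)\<^sup>2 - 1)" (is "?L \<longleftrightarrow> ?R") for s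
  proof -
    have "?L \<longleftrightarrow> real_of_int (6 * s) = real_of_int (24 * int t * int n + int t * ((int t)\<^sup>2 - 1))"
      by (auto simp: field_simps)
    then show ?thesis
      by (simp only: of_int_eq_iff)
  qed
  then show ?thesis
    unfolding W_def mem_Collect_eq by blast
qed

lemma w_vec_abacus:
  assumes "beta_set xs = abacus t m"
  shows "w_vec t xs = map (\<lambda>k. 2 * int t * m k + 2 * int k + 1 - int t) [0..<t div 2]"
  unfolding w_vec_def using n_entry_abacus[OF assms] by (intro map_cong) auto

text \<open>The coordinates determine \<open>m\<close> on the first half of the indices,
  antisymmetry determines the rest, and \<open>m\<close> determines the beads.\<close>

lemma w_vec_inj_on:
  assumes "1 \<le> t"
  shows "inj_on (w_vec t) (SC t n)"
proof (rule inj_onI)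
  fix xs ys assume "xs \<in> SC t n" "ys \<in> SC t n" and eq: "w_vec t xs = w_vec t ys"
  then obtain m l where
    xs: "sorted_wrt (\<ge>) xs" "\<forall>x\<in>set xs. 0 < x" "beta_set xs = abacus t m"
      "\<forall>i<t. m (t - 1 - i) = - m i" and
    ys: "sorted_wrt (\<ge>) ys" "\<forall>x\<in>set ys. 0 < x" "beta_set ys = abacus t l"
      "\<forall>i<t. l (t - 1 - i) = - l i"
    unfolding SC_iff_abacus[OF assms] by blast
  have low: "m k = l k" if "k < t div 2" for k
    using eq that assms by (simp add: w_vec_abacus[OF xs(3)] w_vec_abacus[OF ys(3)])
  have "m i = l i" if "i < t" for i
  proof -
    consider "i < t div 2" | "t - 1 - i < t div 2" | "t - 1 - i = i"
      using \<open>i < t\<close> by linarith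
    then show ?thesis
    proof cases
      case 1
      then show ?thesis by (rule low)
    next
      case 2
      then show ?thesis using low[OF 2] xs(4) ys(4) that by simp
    next
      case 3
      then show ?thesis
        using xs(4)[rule_format, OF that] ys(4)[rule_format, OF that] by simp
    qed
  qed
  then have "abacus t m = abacus t l"
    using assms by (auto simp: abacus_def nat_less_iff)
  then show "xs = ys"
    using beta_set_inject[OF xs(1,2) ys(1,2)] xs(3) ys(3) by simp
qed

lemma w_vec_in_W:
  assumes "1 \<le> t" "xs \<in> SC t n"
  shows "w_vec t xs \<in> W t n"
proof -
  obtain m where
    xs: "sorted_wrt (\<ge>) xs" "beta_set xs = abacus t m" "\<forall>i<t. m (t - 1 - i) = - m i"
      "sum_list xs = n"
    using assms(2) unfolding SC_iff_abacus[OF assms(1)] by blast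
  show ?thesis
    using sum_list_eq_abacus[OF assms(1) xs(1-3)] xs(4)
    by (auto simp: W_iff w_vec_abacus[OF xs(2)] cong_iff_dvd_diff algebra_simps)
qed

text \<open>The congruences provide the first half of \<open>m\<close>. Its antisymmetric extension
  sums to 0, so the abacus is the bead set of a partition, and the quadratic equation then fixes the
  size.\<close>

lemma W_subset_image_w_vec:
  assumes "1 \<le> t" "w \<in> W t n"
  shows "w \<in> w_vec t ` SC t n"
proof -
  have w: "length w = t div 2"
    "6 * (\<Sum>k<t div 2. (w ! k)\<^sup>2) = 24 * int t * int n + int t * ((int t)\<^sup>2 - 1)"
    "\<forall>k<t div 2. [w ! k = 2 * int k + 1 - int t] (mod (2 * int t))"
    using assms(2) unfolding W_iff by auto
  have "\<forall>k<t div 2. \<exists>q. w ! k = 2 * int t * q + 2 * int k + 1 - int t"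
  proof (intro allI impI)
    fix k assume "k < t div 2"
    with w(3) have "2 * int t dvd w ! k - (2 * int k + 1 - int t)"
      by (simp add: cong_iff_dvd_diff)
    then obtain q where "w ! k - (2 * int k + 1 - int t) = 2 * int t * q" ..
    then show "\<exists>q. w ! k = 2 * int t * q + 2 * int k + 1 - int t"
      by (intro exI[of _ q]) simp
  qed
  then obtain q where q: "\<And>k. k < t div 2 \<Longrightarrow> w ! k = 2 * int t * q k + 2 * int k + 1 - int t"
    by metis
  \<comment> \<open>The final case is the middle index of an odd \<open>t\<close>, where
    antisymmetry forces 0.\<close>
  define m where "m i = (if i < t div 2 then q i
    else if t - 1 - i < t div 2 then - q (t - 1 - i) else 0)" for i
  have anti: "\<forall>i<t. m (t - 1 - i) = - m i"
    by (auto simp: m_def)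
  obtain M where M: "\<forall>i<t. - int M \<le> m i"
    using lower_bound_lessThan by blast
  have "{..< - int (t * M)} \<subseteq> abacus t m"
  proof
    fix z assume z: "z \<in> {..< - int (t * M)}"
    have "z div int t < - int M"
    proof (rule ccontr)
      assume "\<not> z div int t < - int M"
      then have "int t * (- int M) \<le> int t * (z div int t)"
        by (intro mult_left_mono) auto
      also have "\<dots> \<le> z"
        using assms(1) pos_mod_sign[of "int t" z] mult_div_mod_eq[of "int t" z] by linarith
      finally show False using z by simp
    qed
    moreover have "nat (z mod int t) < t"
      using assms(1) by (simp add: nat_less_iff)
    ultimately show "z \<in> abacus t m"
      using M by (fastforce simp: abacus_def)
  qed
  moreover have "card (abacus t m \<inter> {- int (t * M)..}) = t * M"
    using card_abacus_truncate[OF assms(1) M] sum_antisymmetric[OF anti] by linarith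
  ultimately obtain xs where
    xs: "sorted_wrt (\<ge>) xs" "\<forall>x\<in>set xs. 0 < x" "beta_set xs = abacus t m"
    using partition_of_beta_set finite_abacus_truncate[OF assms(1)] by blast
  have wm: "w ! k = 2 * int t * m k + 2 * int k + 1 - int t" if "k < t div 2" for k
    using q[OF that] that by (simp add: m_def)
  have "w_vec t xs = w"
    unfolding w_vec_abacus[OF xs(3)] by (rule nth_equalityI) (auto simp: w(1) wm)
  moreover have "sum_list xs = n"
  proof -
    have "24 * int t * int (sum_list xs) = 24 * int t * int n"
      using sum_list_eq_abacus[OF assms(1) xs(1,3) anti] w(2) by (simp add: wm)
    then show ?thesis using assms(1) by simp
  qed
  then have "xs \<in> SC t n"
    using xs anti unfolding SC_iff_abacus[OF assms(1)] by blast
  ultimately show ?thesis by blast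
qed

theorem theorem1p5:
  fixes t n :: nat
  assumes "1 \<le> t"
  shows "bij_betw (w_vec t) (SC t n) (W t n)"
  using w_vec_inj_on[OF assms] w_vec_in_W[OF assms] W_subset_image_w_vec[OF assms]
  by (auto simp: bij_betw_def)

end
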